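(* Let $D,G\ge 0$ be integers, let $d_1,\dots,d_D$, $g_1,\dots,g_G$, $p,p'$ be complex numbers such that none of $g_1,\dots,g_G,\,p,\,p',\,p+p'-1$ is zero or a negative integer, and write $((d),k)=\prod_{j=1}^D(d_j,k)$, $((g),k)=\prod_{j=1}^G(g_j,k)$. Then, for all complex $x,y$ for which the series concerned converge or terminate, $$\sum_{m,n=0}^\infty\frac{((d),m+n)(-1)^n x^{m+n}}{((g),m+n)(p,m)(p',n)}L_m^{(p-1)}(y)\,L_n^{(p'-1)}(-y)={}_{D+2}F_{G+3}\left[\begin{matrix}d_1,\dots,d_D,\ \frac{p+p'-1}{2},\ \frac{p+p'}{2}\\ g_1,\dots,g_G,\ p,\ p',\ p+p'-1\end{matrix};\,-4xy\right].$$
   Context: $(\alpha,n)=\alpha(\alpha+1)\cdots(\alpha+n-1)$ for $n\ge1$ and $(\alpha,0)=1$ (Pochhammer symbol). The generalized hypergeometric function is ${}_PF_Q[\alpha_1,\dots,\alpha_P;\beta_1,\dots,\beta_Q;z]=\sum_{n\ge0}\frac{(\alpha_1,n)\cdots(\alpha_P,n)}{(\beta_1,n)\cdots(\beta_Q,n)}\frac{z^n}{n!}$. The Laguerre polynomial is $L_n^{(a)}(x)=\frac{(a+1,n)}{n!}\,{}_1F_1[-n;a+1;x]=\frac{1}{n!}\sum_{k=0}^n\frac{(-n,k)\,(a+1,n)}{(a+1,k)\,k!}x^k$. A double series $\sum_{m,n=0}^\infty c_{m,n}x^{m+n}$ is understood as the power series $\sum_{N=0}^\infty\big(\sum_{m+n=N}c_{m,n}\big)x^N$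 in $x$. *)

theory Defs
  imports "HOL-Analysis.Analysis"
begin

text \<open>
  A series written as a sum over powers of a variable is represented by the formal power series
  of its coefficients, and its value is \<open>eval_fps\<close>.  As \<open>eval_fps\<close> is \<open>suminf\<close> and hence
  unspecified at points of divergence, convergence at a point is a separate predicate; a
  terminating series converges everywhere in this sense.
\<close>

definition fps_converges_at :: "complex fps \<Rightarrow> complex \<Rightarrow> bool" where
  "fps_converges_at f z \<longleftrightarrow> summable (\<lambda>n. fps_nth f n * z ^ n)"

text \<open>The double series \<open>\<Sum>m n. c m n * x ^ (m + n)\<close>, read as a power series in \<open>x\<close>.\<close>

definition double_series :: "(nat \<Rightarrow> nat \<Rightarrow> complex) \<Rightarrow> complex fps" where
  "double_series c = Abs_fps (\<lambda>N. \<Sum>(m, n) | m + n = N. c m n)"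

definition poch_list :: "complex list \<Rightarrow> nat \<Rightarrow> complex" where
  "poch_list as k = (\<Prod>a\<leftarrow>as. pochhammer a k)"

text \<open>
  The third argument of \<open>fps_hypergeo\<close> is a scaling factor of the variable; with scaling factor
  1 it is the series of the generalized hypergeometric function with upper parameters \<open>as\<close> and
  lower parameters \<open>bs\<close>.
\<close>

abbreviation hypergeo_fps :: "complex list \<Rightarrow> complex list \<Rightarrow> complex fps" where
  "hypergeo_fps as bs \<equiv> fps_hypergeo as bs 1"

definition hypergeo :: "complex list \<Rightarrow> complex list \<Rightarrow> complex \<Rightarrow> complex" where
  "hypergeo as bs z = eval_fps (hypergeo_fps as bs) z"

lemma hypergeo_fps_nth:
  "fps_nth (hypergeo_fps as bs) n = poch_list as n / (poch_list bs n * fact n)"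
proof -
  have "foldl (\<lambda>r a. r * pochhammer a n) c xs = c * poch_list xs n" for c :: complex and xs
    by (induction xs arbitrary: c) (simp_all add: poch_list_def mult.assoc)
  then show ?thesis
    by simp
qed

definition Laguerre :: "nat \<Rightarrow> complex \<Rightarrow> complex \<Rightarrow> complex" where
  "Laguerre n a x = pochhammer (a + 1) n / fact n * hypergeo [- of_nat n] [a + 1] x"

lemma Laguerre_altdef:
  "Laguerre n a x = 1 / fact n *
     (\<Sum>k\<le>n. pochhammer (- of_nat n) k * pochhammer (a + 1) n / (pochhammer (a + 1) k * fact k) * x ^ k)"
proof -
  have "hypergeo [- of_nat n] [a + 1] x =
      (\<Sum>k\<le>n. pochhammer (- of_nat n) k / (pochhammer (a + 1) k * fact k) * x ^ k)"
    unfolding hypergeo_def eval_fps_def hypergeo_fps_nth poch_list_def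
    by (subst suminf_finite[of "{..n}"]) (auto simp: pochhammer_eq_0_iff)
  then show ?thesis
    by (simp add: Laguerre_def sum_distrib_left mult_ac)
qed

end

(* Dividing the Laguerre polynomials by Pochhammer symbols gives the generating function
   exp t * 0F1(; p; - t y).  In the product over (p, y, t) and (p', - y, - t) the exponentials
   cancel, so the N-th coefficient becomes that of 0F1(; p; - t y) * 0F1(; p'; - t y), which
   Chu-Vandermonde and the duplication formula for Pochhammer symbols put in closed form.
   The double series and the hypergeometric series therefore agree term by term. *)
theory Submission
  imports Defs
begin

lemma pochhammer_nonzero:
  fixes a :: complex
  assumes "a \<notin> \<int>\<^sub>\<le>\<^sub>0"
  shows "pochhammer a n \<noteq> 0"
  using assms by (auto simp: pochhammer_eq_0_iff)

text \<open>Compares two expressions for \<open>n choose k\<close>: the one by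
  \<open>gbinomial\<close>, which contains the Pochhammer symbol, and the quotient of
  factorials.\<close>

lemma pochhammer_minus_of_nat:
  assumes "k \<le> n"
  shows "pochhammer (- of_nat n) k = ((-1) ^ k * fact n / fact (n - k) :: complex)"
proof -
  have "of_nat (n choose k) = ((-1) ^ k * pochhammer (- of_nat n) k / fact k :: complex)"
    by (simp add: binomial_gbinomial gbinomial_pochhammer)
  moreover have "of_nat (n choose k) = (fact n / (fact k * fact (n - k)) :: complex)"
    using assms by (rule binomial_fact)
  ultimately have "(-1) ^ k * pochhammer (- of_nat n) k = (fact n / fact (n - k) :: complex)"
    by (simp add: field_simps)
  then have "(-1) ^ k * ((-1) ^ k * pochhammer (- of_nat n) k)
      = (-1) ^ k * (fact n / fact (n - k) :: complex)"
    by simp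
  then show ?thesis
    by (simp flip: mult.assoc power_mult_distrib)
qed

text \<open>The division cancels the factor \<open>pochhammer p n\<close> of the Laguerre
  polynomial. What remains is a convolution with the coefficients \<open>1 / fact (n - k)\<close> of
  the exponential series.\<close>

lemma Laguerre_over_pochhammer:
  assumes "p \<notin> \<int>\<^sub>\<le>\<^sub>0"
  shows "Laguerre n (p - 1) y / pochhammer p n
    = (\<Sum>k\<le>n. (- y) ^ k / (pochhammer p k * fact k) * (1 / fact (n - k)))"
proof -
  have "Laguerre n (p - 1) y / pochhammer p n
      = (\<Sum>k\<le>n. 1 / fact n * (pochhammer (- of_nat n) k * pochhammer p n
          / (pochhammer p k * fact k) * y ^ k) / pochhammer p n)"
    by (simp add: Laguerre_altdef sum_distrib_left sum_divide_distrib)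
  also have "\<dots> = (\<Sum>k\<le>n. (- y) ^ k / (pochhammer p k * fact k) * (1 / fact (n - k)))"
    using pochhammer_nonzero[OF assms]
    by (intro sum.cong)
      (auto simp: pochhammer_minus_of_nat power_minus[of y])
  finally show ?thesis .
qed

text \<open>The constant \<open>c\<close> rescales the variable of the generating function; the
  values 1 and -1 are the ones needed, the latter for the sign \<open>(-1) ^ n\<close> of the double
  series.\<close>

lemma Laguerre_genfun:
  assumes "p \<notin> \<int>\<^sub>\<le>\<^sub>0"
  shows "Abs_fps (\<lambda>n. c ^ n * Laguerre n (p - 1) y / pochhammer p n)
    = Abs_fps (\<lambda>k. (- (c * y)) ^ k / (pochhammer p k * fact k)) * fps_exp c"
proof (rule fps_ext)
  fix n
  have "c ^ n * Laguerre n (p - 1) y / pochhammer p n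
      = (\<Sum>k\<le>n. c ^ n * ((- y) ^ k / (pochhammer p k * fact k) * (1 / fact (n - k))))"
    by (simp only: Laguerre_over_pochhammer[OF assms] sum_distrib_left times_divide_eq_right[symmetric])
  also have "\<dots> = (\<Sum>k\<le>n. (- (c * y)) ^ k / (pochhammer p k * fact k) * (c ^ (n - k) / fact (n - k)))"
  proof (rule sum.cong)
    fix k assume "k \<in> {..n}"
    then have "c ^ n = c ^ k * c ^ (n - k)"
      by (simp flip: power_add)
    then show "c ^ n * ((- y) ^ k / (pochhammer p k * fact k) * (1 / fact (n - k)))
        = (- (c * y)) ^ k / (pochhammer p k * fact k) * (c ^ (n - k) / fact (n - k))"
      by (simp add: power_minus[of y] power_minus[of "c * y"] power_mult_distrib)
  qed simp
  finally show "fps_nth (Abs_fps (\<lambda>n. c ^ n * Laguerre n (p - 1) y / pochhammer p n)) n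
      = fps_nth (Abs_fps (\<lambda>k. (- (c * y)) ^ k / (pochhammer p k * fact k)) * fps_exp c) n"
    by (simp add: fps_mult_nth atLeast0AtMost)
qed

text \<open>The quotient is the product of \<open>a + k\<close>, ..., \<open>a + n - 1\<close>.
  Negated and read backwards, these factors start at \<open>1 - a - n\<close>, a base free of
  \<open>k\<close>, as Chu-Vandermonde requires.\<close>

lemma pochhammer_quotient:
  fixes a :: complex
  assumes "a \<notin> \<int>\<^sub>\<le>\<^sub>0" "k \<le> n"
  shows "pochhammer a n / pochhammer a k = (-1) ^ (n - k) * pochhammer (1 - a - of_nat n) (n - k)"
proof -
  have "pochhammer a n / pochhammer a k = pochhammer (a + of_nat k) (n - k)"
    using pochhammer_product[OF assms(2), of a] pochhammer_nonzero[OF assms(1)] by simp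
  also have "\<dots> = (-1) ^ (n - k) * pochhammer (1 - a - of_nat n) (n - k)"
    using pochhammer_minus'[of "1 - a - of_nat n" "n - k"]
      pochhammer_minus[of "a + of_nat n - 1" "n - k"] assms(2)
    by (simp add: of_nat_diff algebra_simps)
  finally show ?thesis .
qed

text \<open>Over the common denominator each summand becomes a product of Pochhammer symbols of
  lengths \<open>k\<close> and \<open>n - k\<close> with fixed bases, so Chu-Vandermonde
  applies.\<close>

lemma sum_inverse_pochhammer:
  fixes p q :: complex
  assumes "p \<notin> \<int>\<^sub>\<le>\<^sub>0" "q \<notin> \<int>\<^sub>\<le>\<^sub>0"
  shows "(\<Sum>k\<le>n. of_nat (n choose k) / (pochhammer p k * pochhammer q (n - k)))
    = pochhammer (p + q - 1 + of_nat n) n / (pochhammer p n * pochhammer q n)"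
proof -
  define a b where "a = 1 - p - of_nat n" and "b = 1 - q - of_nat n"
  note nz = pochhammer_nonzero[OF assms(1)] pochhammer_nonzero[OF assms(2)]
  have "(\<Sum>k\<le>n. of_nat (n choose k) / (pochhammer p k * pochhammer q (n - k)))
      = (\<Sum>k\<le>n. of_nat (n choose k) * (pochhammer p n / pochhammer p k)
          * (pochhammer q n / pochhammer q (n - k))) / (pochhammer p n * pochhammer q n)"
    using nz by (simp add: sum_divide_distrib)
  also have "(\<Sum>k\<le>n. of_nat (n choose k) * (pochhammer p n / pochhammer p k)
          * (pochhammer q n / pochhammer q (n - k)))
      = (\<Sum>k\<le>n. (-1) ^ n * (of_nat (n choose k) * pochhammer b k * pochhammer a (n - k)))"
  proof (rule sum.cong)
    fix k assume "k \<in> {..n}"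
    then have k: "k \<le> n" by simp
    then have s: "(-1) ^ n = ((-1) ^ (n - k) * (-1) ^ k :: complex)"
      by (simp flip: power_add)
    show "of_nat (n choose k) * (pochhammer p n / pochhammer p k)
          * (pochhammer q n / pochhammer q (n - k))
      = (-1) ^ n * (of_nat (n choose k) * pochhammer b k * pochhammer a (n - k))"
      \<comment> \<open>For \<open>q\<close> the quotient lemma is used with \<open>n - k\<close> in
        place of \<open>k\<close>, which leaves the length \<open>n - (n - k) = k\<close>.\<close>
      unfolding pochhammer_quotient[OF assms(1) k] pochhammer_quotient[OF assms(2) diff_le_self]
      using k by (simp add: s a_def b_def)
  qed simp
  also have "\<dots> = (-1) ^ n * pochhammer (b + a) n"
    by (simp add: pochhammer_binomial_sum sum_distrib_left)
  also have "\<dots> = pochhammer (p + q - 1 + of_nat n) n"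
    \<comment> \<open>Here \<open>b + a = - (p + q + 2 * n - 2)\<close>; reflecting it absorbs the
      sign \<open>(-1) ^ n\<close>.\<close>
    using pochhammer_minus[of "p + q + 2 * of_nat n - 2" n]
    by (simp add: a_def b_def algebra_simps flip: power_mult_distrib)
  finally show ?thesis .
qed

text \<open>Splits \<open>pochhammer s (2 * n)\<close> once in the middle and once by parity of the
  factors. With \<open>s = p + q - 1\<close> this is the source of the halved upper parameters, the
  lower parameter \<open>p + q - 1\<close> and the 4 in the argument.\<close>

lemma pochhammer_duplication:
  fixes s :: complex
  assumes "s \<notin> \<int>\<^sub>\<le>\<^sub>0"
  shows "pochhammer (s + of_nat n) n
    = 4 ^ n * pochhammer (s / 2) n * pochhammer ((s + 1) / 2) n / pochhammer s n"
proof -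
  have "pochhammer s n * pochhammer (s + of_nat n) n = pochhammer s (2 * n)"
    by (simp add: pochhammer_product'[symmetric] mult_2)
  also have "\<dots> = 4 ^ n * pochhammer (s / 2) n * pochhammer ((s + 1) / 2) n"
    using pochhammer_double[of "s / 2" n] by (simp add: power_mult add_divide_distrib)
  finally show ?thesis
    using pochhammer_nonzero[OF assms] by (simp add: field_simps)
qed

lemma sum_Laguerre_product:
  assumes "p \<notin> \<int>\<^sub>\<le>\<^sub>0" "q \<notin> \<int>\<^sub>\<le>\<^sub>0" "p + q - 1 \<notin> \<int>\<^sub>\<le>\<^sub>0"
  shows "(\<Sum>m\<le>N. Laguerre m (p - 1) y / pochhammer p m
        * ((-1) ^ (N - m) * Laguerre (N - m) (q - 1) (- y) / pochhammer q (N - m)))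
    = pochhammer ((p + q - 1) / 2) N * pochhammer ((p + q) / 2) N
        / (pochhammer p N * pochhammer q N * pochhammer (p + q - 1) N * fact N) * (- 4 * y) ^ N"
    (is "?lhs = ?rhs")
proof -
  \<comment> \<open>\<open>F r\<close> is 0F1(; r; - t y) as a series in t. The same
    \<open>- y\<close> serves both factors, because \<open>c * y\<close> is unchanged when
    \<open>c\<close> and \<open>y\<close> both change sign.\<close>
  define F where "F = (\<lambda>r. Abs_fps (\<lambda>k. (- y) ^ k / (pochhammer r k * fact k)))"
  \<comment> \<open>The trivial factor \<open>1 ^ n\<close> gives \<open>A\<close> the shape of
    \<open>Laguerre_genfun\<close> for \<open>c = 1\<close>.\<close>
  define A where "A = Abs_fps (\<lambda>n. 1 ^ n * Laguerre n (p - 1) y / pochhammer p n)"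
  define B where "B = Abs_fps (\<lambda>n. (-1) ^ n * Laguerre n (q - 1) (- y) / pochhammer q n)"
  have "A = F p * fps_exp 1"
    unfolding A_def F_def Laguerre_genfun[OF assms(1)] by simp
  moreover have "B = F q * fps_exp (- 1)"
    unfolding B_def F_def Laguerre_genfun[OF assms(2)] by simp
  moreover have "fps_exp 1 * fps_exp (- 1) = (1 :: complex fps)"
    by (simp flip: fps_exp_add_mult)
  ultimately have "A * B = F p * F q"
    by (metis mult.assoc mult.commute mult.left_commute mult_1)
  moreover have "?lhs = fps_nth (A * B) N"
    by (simp add: A_def B_def fps_mult_nth atLeast0AtMost)
  ultimately have "?lhs = fps_nth (F p * F q) N" by simp
  also have "\<dots> = (\<Sum>k\<le>N. (- y) ^ N / fact N
      * (of_nat (N choose k) / (pochhammer p k * pochhammer q (N - k))))"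
    unfolding fps_mult_nth atLeast0AtMost F_def fps_nth_Abs_fps
  proof (rule sum.cong)
    fix k assume "k \<in> {..N}"
    then have k: "k \<le> N" by simp
    then have "(- y) ^ N = (- y) ^ k * (- y) ^ (N - k)"
      by (simp flip: power_add)
    then show "(- y) ^ k / (pochhammer p k * fact k)
          * ((- y) ^ (N - k) / (pochhammer q (N - k) * fact (N - k)))
        = (- y) ^ N / fact N * (of_nat (N choose k) / (pochhammer p k * pochhammer q (N - k)))"
      by (simp add: binomial_fact[OF k] mult_ac)
  qed simp
  also have "\<dots> = (- y) ^ N / fact N
      * (pochhammer (p + q - 1 + of_nat N) N / (pochhammer p N * pochhammer q N))"
    by (simp only: sum_inverse_pochhammer[OF assms(1,2)] flip: sum_distrib_left)
  also have "\<dots> = ?rhs"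
    unfolding pochhammer_duplication[OF assms(3)]
    using power_mult_distrib[of 4 "- y" N] by (simp add: mult_ac)
  finally show ?thesis .
qed

lemma double_series_nth: "fps_nth (double_series c) N = (\<Sum>m\<le>N. c m (N - m))"
  unfolding double_series_def fps_nth_Abs_fps
  by (rule sum.reindex_bij_witness[of _ "\<lambda>m. (m, N - m)" fst]) auto

theorem mainTheorem1:
  fixes ds gs :: "complex list" and p p' x y :: complex
  defines "L \<equiv> double_series (\<lambda>m n.
      poch_list ds (m + n) * (-1) ^ n /
        (poch_list gs (m + n) * pochhammer p m * pochhammer p' n) *
      Laguerre m (p - 1) y * Laguerre n (p' - 1) (- y))"
    and "as \<equiv> ds @ [(p + p' - 1) / 2, (p + p') / 2]"
    and "bs \<equiv> gs @ [p, p', p + p' - 1]"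
  assumes "\<forall>g\<in>set gs. g \<notin> \<int>\<^sub>\<le>\<^sub>0"
    and "p \<notin> \<int>\<^sub>\<le>\<^sub>0" and "p' \<notin> \<int>\<^sub>\<le>\<^sub>0" and "p + p' - 1 \<notin> \<int>\<^sub>\<le>\<^sub>0"
    and "fps_converges_at L x"
    and "fps_converges_at (hypergeo_fps as bs) (- 4 * x * y)"
  shows "eval_fps L x = hypergeo as bs (- 4 * x * y)"
proof -
  have coeff: "fps_nth L N = fps_nth (hypergeo_fps as bs) N * (- 4 * y) ^ N" for N
  proof -
    \<comment> \<open>On the diagonal \<open>m + n = N\<close> the factors from \<open>ds\<close>
      and \<open>gs\<close> are constant and leave the sum.\<close>
    have "fps_nth L N = (\<Sum>m\<le>N. poch_list ds N / poch_list gs N * (Laguerre m (p - 1) y / pochhammer p m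
        * ((-1) ^ (N - m) * Laguerre (N - m) (p' - 1) (- y) / pochhammer p' (N - m))))"
      unfolding L_def double_series_nth by (intro sum.cong) (auto simp: mult_ac)
    also have "\<dots> = poch_list ds N / poch_list gs N
        * (pochhammer ((p + p' - 1) / 2) N * pochhammer ((p + p') / 2) N
        / (pochhammer p N * pochhammer p' N * pochhammer (p + p' - 1) N * fact N) * (- 4 * y) ^ N)"
      by (simp only: sum_Laguerre_product[OF assms(5-7)] flip: sum_distrib_left)
    also have "\<dots> = fps_nth (hypergeo_fps as bs) N * (- 4 * y) ^ N"
      unfolding hypergeo_fps_nth as_def bs_def by (simp add: poch_list_def mult_ac)
    finally show ?thesis .
  qed
  show ?thesis
    unfolding hypergeo_def eval_fps_def coeff
    \<comment> \<open>Merges \<open>(- 4 * y) ^ N\<close> with \<open>x ^ N\<close> into one power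
      of the argument.\<close>
    by (simp only: mult.assoc mult.commute[of x y] flip: power_mult_distrib)
qed

end
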